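(* Let $\chi$ be a parameter with the mixed bias property over $\mathcal{M}$, with associated statistic $S_{ab}$ and linear maps $m_1, m_2$, let $O_1,\dots,O_n$ be the observed sample with empirical mean operator $\mathbb{P}_n$, and let $\phi(Z)=[\phi_1(Z),\dots,\phi_d(Z)]^\top$ be a vector of given features. Let $\widehat{\beta}\in\mathbb{R}^d$ be any vector and put $\widehat{a}(Z):=\widehat{\beta}^\top\phi(Z)$. Let $\widehat{b}$ be any estimator of $b_P$ (any function of $Z$, possibly depending on the sample, not necessarily linear in $\phi$). Let $\widetilde{\beta}\in\mathbb{R}^d$ be any vector satisfying $$\mathbb{P}_n\left\{S_{ab}\,\widehat{b}(Z)\,\phi(Z)^\top\widetilde{\beta}+m_2(O,\widehat{b})\right\}=0 .$$ Assume $\mathbb{P}_n\{m_1(O,\phi_j)\}\neq 0$ for $j=1,\dots,d$, and define $$\gamma_j:=\frac{\mathbb{P}_n\left\{-S_{ab}\,\widehat{b}(Z)\,\phi_j(Z)\right\}}{\mathbb{P}_n\left\{m_1(O,\phi_j)\right\}},\qquad \widetilde{\beta}_{aug,j}:=(1-\gamma_j)\widehat{\beta}_j+\gamma_j\widetilde{\beta}_j,\qquad j=1,\dots,d,$$ and $\widetilde{a}_{aug}(Z):=\widetilde{\beta}_{aug}^\top\phi(Z)$. Then $$\widehat{\chi}_{\widehat{a},\widehat{b}}=\widehat{\chi}_{\widetilde{a}_{aug},0}.$$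
   Context: Setting. $O_1,\dots,O_n$ are i.i.d. copies of a random vector $O$ with unknown law $P_0$ in a non-parametric model $\mathcal{M}$ (the tangent space at each $P\in\mathcal{M}$ is $L^2(P)$); $Z$ is a subvector of $O$. The scalar functional $P\mapsto\chi(P)$ is pathwise differentiable at every $P\in\mathcal{M}$, with unique influence function $\chi_P^1$. Mixed bias property: $\chi$ has the mixed bias property over $\mathcal{M}$ if there is a statistic $S_{ab}=s_{ab}(O)$ such that for all $P,P'\in\mathcal{M}$ there are functions $a_P,b_P\in L^2(P_Z)$ and $a_{P'},b_{P'}\in L^2(P'_Z)$ with $$\chi(P')-\chi(P)+E_P\{\chi^1_{P'}(O)\}=E_P\left[S_{ab}\{a_{P'}(Z)-a_P(Z)\}\{b_{P'}(Z)-b_P(Z)\}\right].$$ For such parameters (under regularity conditions, taken for granted) there are maps $h\mapsto m_1(O,h)$ and $h\mapsto m_2(O,h)$, linear in $h$, such that for all $P\in\mathcal{M}$ $$\chi^1_P(O)=S_{ab}a_P(Z)b_P(Z)+m_1(O,a_P)+m_2(O,b_P)-\chi(P),$$ where an additional additive statistic $S_0$ is taken to be $0$ without loss of generality. It is also assumed throughout that $E_P(S_{ab}\mid Z)\neq 0$ almost surely under $P$, for all $P\in\mathcal{M}$. The maps $m_1(O,\cdot)$ and $m_2(O,\cdot)$ are understood to be defined and linear on real vector spaces of functions of $Z$ containing, respectively, the candidate functions for $a_P$ (including $\phi_1,\dots,\phi_d$) and the candidate functions for $b_P$ (including $\widehat{b}$). Notation. $\mathbb{P}_n$ is the empirical mean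 operator, $\mathbb{P}_n\{f(O)\}=n^{-1}\sum_{i=1}^n f(O_i)$; sample-dependent functions such as $\widehat{a},\widehat{b}$ are held fixed as functions inside $\mathbb{P}_n$. For functions $a,b$ of $Z$, $$\widehat{\chi}_{a,b}:=\mathbb{P}_n\{S_{ab}a(Z)b(Z)\}+\mathbb{P}_n\{m_1(O,a)\}+\mathbb{P}_n\{m_2(O,b)\}.$$ In $\widehat{\chi}_{a,0}$ the second function is identically zero, so by linearity of $m_2$, $\widehat{\chi}_{a,0}=\mathbb{P}_n\{m_1(O,a)\}$. The asserted equality is an algebraic identity holding for the given sample. *)

theory Defs
  imports "HOL-Probability.Probability"
begin

definition L2 :: "'a measure \<Rightarrow> ('a \<Rightarrow> real) set" where
  "L2 P = {f \<in> borel_measurable P. integrable P (\<lambda>x. (f x)\<^sup>2)}"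

definition L2_0 :: "'a measure \<Rightarrow> ('a \<Rightarrow> real) set" where
  "L2_0 P = {f \<in> L2 P. (\<integral>x. f x \<partial>P) = 0}"

(* One-dimensional submodels t \<mapsto> Q t of M through P = Q 0 that are dominated and
   differentiable in quadratic mean at t = 0 with score g.  Only the values of Q near 0 matter. *)
definition regular_submodel ::
  "'a measure set \<Rightarrow> 'a measure \<Rightarrow> (real \<Rightarrow> 'a measure) \<Rightarrow> ('a \<Rightarrow> real) \<Rightarrow> bool" where
  "regular_submodel M P Q g \<longleftrightarrow>
     Q 0 = P \<and> g \<in> L2 P \<and>
     (\<exists>\<epsilon>>0. \<exists>\<mu> p. sigma_finite_measure \<mu> \<and> sets \<mu> = sets P \<and>
        (\<forall>t. \<bar>t\<bar> < \<epsilon> \<longrightarrow> Q t \<in> M \<and> p t \<in> borel_measurable \<mu> \<and> (\<forall>x. 0 \<le> p t x) \<and>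
              Q t = density \<mu> (\<lambda>x. ennreal (p t x))) \<and>
        ((\<lambda>t. \<integral>x. ((sqrt (p t x) - sqrt (p 0 x)) / t - 1/2 * g x * sqrt (p 0 x))\<^sup>2 \<partial>\<mu>)
            \<longlongrightarrow> 0) (at 0))"

(* The tangent space at P is the closed linear span of the scores.  Scores have mean zero, so the
   maximal tangent space "L2(P)" of a non-parametric model is the space of mean-zero functions;
   it is full iff the finite linear combinations of scores are dense in that space. *)
definition nonparametric_model :: "'a measure \<Rightarrow> 'a measure set \<Rightarrow> bool" where
  "nonparametric_model S M \<longleftrightarrow>
     (\<forall>P\<in>M. prob_space P \<and> sets P = sets S) \<and>
     (\<forall>P\<in>M. \<forall>h\<in>L2_0 P. \<forall>\<epsilon>>0. \<exists>(k::nat) c g.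
        (\<forall>i<k. \<exists>Q. regular_submodel M P Q (g i)) \<and>
        (\<integral>x. (h x - (\<Sum>i<k. c i * g i x))\<^sup>2 \<partial>P) < \<epsilon>)"

definition influence_function ::
  "'a measure set \<Rightarrow> ('a measure \<Rightarrow> real) \<Rightarrow> 'a measure \<Rightarrow> ('a \<Rightarrow> real) \<Rightarrow> bool" where
  "influence_function M chi P \<psi> \<longleftrightarrow>
     \<psi> \<in> L2_0 P \<and>
     (\<forall>Q g. regular_submodel M P Q g \<longrightarrow>
        ((\<lambda>t. chi (Q t)) has_real_derivative (\<integral>x. \<psi> x * g x \<partial>P)) (at 0))"

(* chi1 P is the influence function at P; Z maps an observation to its subvector, with values in
   the measurable space SZ, so that distr P SZ Z is the law of Z under P.  The integrability
   conditions say that the expectations in the displayed identity exist (a non-integrable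
   function would have Bochner integral 0). *)
definition mixed_bias_property ::
  "'a measure \<Rightarrow> 'z measure \<Rightarrow> ('a \<Rightarrow> 'z) \<Rightarrow> 'a measure set \<Rightarrow> ('a measure \<Rightarrow> real) \<Rightarrow>
   ('a measure \<Rightarrow> 'a \<Rightarrow> real) \<Rightarrow> ('a \<Rightarrow> real) \<Rightarrow> ('a measure \<Rightarrow> 'z \<Rightarrow> real) \<Rightarrow>
   ('a measure \<Rightarrow> 'z \<Rightarrow> real) \<Rightarrow> bool" where
  "mixed_bias_property S SZ Z M chi chi1 sab a b \<longleftrightarrow>
     sab \<in> borel_measurable S \<and>
     (\<forall>P\<in>M. a P \<in> L2 (distr P SZ Z) \<and> b P \<in> L2 (distr P SZ Z)) \<and>
     (\<forall>P\<in>M. \<forall>P'\<in>M.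
        integrable P (chi1 P') \<and>
        integrable P (\<lambda>x. sab x * (a P' (Z x) - a P (Z x)) * (b P' (Z x) - b P (Z x))) \<and>
        chi P' - chi P + (\<integral>x. chi1 P' x \<partial>P) =
          (\<integral>x. sab x * (a P' (Z x) - a P (Z x)) * (b P' (Z x) - b P (Z x)) \<partial>P))"

definition function_space :: "('z \<Rightarrow> real) set \<Rightarrow> bool" where
  "function_space V \<longleftrightarrow>
     (\<lambda>z. 0) \<in> V \<and>
     (\<forall>f\<in>V. \<forall>g\<in>V. (\<lambda>z. f z + g z) \<in> V) \<and>
     (\<forall>c. \<forall>f\<in>V. (\<lambda>z. c * f z) \<in> V)"

definition linear_functional_on :: "('z \<Rightarrow> real) set \<Rightarrow> (('z \<Rightarrow> real) \<Rightarrow> real) \<Rightarrow> bool" where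
  "linear_functional_on V L \<longleftrightarrow>
     (\<forall>f\<in>V. \<forall>g\<in>V. L (\<lambda>z. f z + g z) = L f + L g) \<and>
     (\<forall>c. \<forall>f\<in>V. L (\<lambda>z. c * f z) = c * L f)"

definition emp_mean :: "nat \<Rightarrow> (nat \<Rightarrow> 'a) \<Rightarrow> ('a \<Rightarrow> real) \<Rightarrow> real" where
  "emp_mean n xs f = (\<Sum>i<n. f (xs i)) / real n"

definition chi_hat ::
  "nat \<Rightarrow> (nat \<Rightarrow> 'a) \<Rightarrow> ('a \<Rightarrow> 'z) \<Rightarrow> ('a \<Rightarrow> real) \<Rightarrow> ('a \<Rightarrow> ('z \<Rightarrow> real) \<Rightarrow> real) \<Rightarrow>
   ('a \<Rightarrow> ('z \<Rightarrow> real) \<Rightarrow> real) \<Rightarrow> ('z \<Rightarrow> real) \<Rightarrow> ('z \<Rightarrow> real) \<Rightarrow> real" where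
  "chi_hat n xs Z sab m1 m2 a b =
     emp_mean n xs (\<lambda>x. sab x * a (Z x) * b (Z x)) +
     emp_mean n xs (\<lambda>x. m1 x a) + emp_mean n xs (\<lambda>x. m2 x b)"

end

theory Submission
  imports Defs
begin

text \<open>
  Write \<open>u\<^sub>j\<close> for the empirical mean of \<open>m\<^sub>1(O, \<phi>\<^sub>j)\<close> and \<open>w\<^sub>j\<close> for that of
  \<open>S\<^sub>a\<^sub>b b(Z) \<phi>\<^sub>j(Z)\<close>, where \<open>b\<close> is the estimated second function. Then \<open>\<gamma>\<^sub>j u\<^sub>j = - w\<^sub>j\<close>,
  and the equation for \<open>\<beta>'\<close>, the tilde coefficient vector, says that the empirical mean of
  \<open>m\<^sub>2(O, b)\<close> is \<open>- \<Sum>\<^sub>j w\<^sub>j \<beta>'\<^sub>j\<close>. Expanding with linearity, both sides equal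
  \<open>\<Sum>\<^sub>j ((u\<^sub>j + w\<^sub>j) \<beta>\<^sub>j - w\<^sub>j \<beta>'\<^sub>j)\<close>.
\<close>

lemma function_space_sum:
  assumes "function_space V" and "finite K" and "\<And>j. j \<in> K \<Longrightarrow> f j \<in> V"
  shows "(\<lambda>z. \<Sum>j\<in>K. c j * f j z) \<in> V"
  using assms(2,3)
proof (induction K rule: finite_induct)
  case empty
  then show ?case using assms(1) by (simp add: function_space_def)
next
  case (insert k K)
  then show ?case using assms(1) by (simp add: function_space_def)
qed

text \<open>Homogeneity with scalar 0, applied to the zero function, which lies in \<open>V\<close>.
  This serves both the empty sum in the next lemma and the second argument of \<open>chi_hat\<close>
  on the augmented side.\<close>

lemma linear_functional_on_zero:
  assumes "function_space V" and "linear_functional_on V L"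
  shows "L (\<lambda>z. 0) = 0"
proof -
  have "L (\<lambda>z. c * f z) = c * L f" if "f \<in> V" for c f
    using assms(2) that by (simp add: linear_functional_on_def)
  from this[of "\<lambda>z. 0" 0] show ?thesis
    using assms(1) by (simp add: function_space_def)
qed

text \<open>Additivity is available only inside \<open>V\<close>, so each induction step must first
  place the new term and the remaining sum in \<open>V\<close>.\<close>

lemma linear_functional_on_sum:
  assumes "function_space V" and "linear_functional_on V L"
    and "finite K" and "\<And>j. j \<in> K \<Longrightarrow> f j \<in> V"
  shows "L (\<lambda>z. \<Sum>j\<in>K. c j * f j z) = (\<Sum>j\<in>K. c j * L (f j))"
  using assms(3,4)
proof (induction K rule: finite_induct)
  case empty
  then show ?case using linear_functional_on_zero[OF assms(1,2)] by simp
next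
  case (insert k K)
  then have "(\<lambda>z. c k * f k z) \<in> V"
    using assms(1) by (simp add: function_space_def)
  moreover have "(\<lambda>z. \<Sum>j\<in>K. c j * f j z) \<in> V"
    using insert by (intro function_space_sum[OF assms(1)]) auto
  ultimately show ?case using insert assms(2) by (simp add: linear_functional_on_def)
qed

text \<open>Agreement at the sample points suffices; this matters because linearity of
  \<open>m1 x\<close> and \<open>m2 x\<close> is used only for \<open>x\<close> in the
  sample.\<close>

lemma emp_mean_cong:
  assumes "\<And>i. i < n \<Longrightarrow> f (xs i) = g (xs i)"
  shows "emp_mean n xs f = emp_mean n xs g"
  using assms by (simp add: emp_mean_def)

lemma emp_mean_add:
  "emp_mean n xs (\<lambda>x. f x + g x) = emp_mean n xs f + emp_mean n xs g"
  by (simp add: emp_mean_def sum.distrib add_divide_distrib)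

lemma emp_mean_sum_cmult:
  "emp_mean n xs (\<lambda>x. \<Sum>j\<in>K. c j * f j x) = (\<Sum>j\<in>K. c j * emp_mean n xs (f j))"
  unfolding emp_mean_def by (subst sum.swap) (simp add: sum_distrib_left sum_divide_distrib)

lemma emp_mean_uminus: "emp_mean n xs (\<lambda>x. - f x) = - emp_mean n xs f"
  by (simp add: emp_mean_def sum_negf)

lemma emp_mean_linear_functional:
  fixes \<phi> :: "'z \<Rightarrow> real ^ 'd"
  assumes "function_space A" and "\<And>i. i < n \<Longrightarrow> linear_functional_on A (m (xs i))"
    and "\<And>j. (\<lambda>z. \<phi> z $ j) \<in> A"
  shows "emp_mean n xs (\<lambda>x. m x (\<lambda>z. \<beta> \<bullet> \<phi> z)) =
    (\<Sum>j\<in>UNIV. \<beta> $ j * emp_mean n xs (\<lambda>x. m x (\<lambda>z. \<phi> z $ j)))"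
proof -
  have "emp_mean n xs (\<lambda>x. m x (\<lambda>z. \<beta> \<bullet> \<phi> z)) =
      emp_mean n xs (\<lambda>x. \<Sum>j\<in>UNIV. \<beta> $ j * m x (\<lambda>z. \<phi> z $ j))"
  proof (rule emp_mean_cong)
    fix i assume "i < n"
    then show "m (xs i) (\<lambda>z. \<beta> \<bullet> \<phi> z) = (\<Sum>j\<in>UNIV. \<beta> $ j * m (xs i) (\<lambda>z. \<phi> z $ j))"
      using linear_functional_on_sum[OF assms(1) assms(2), of i UNIV "\<lambda>j z. \<phi> z $ j" "\<lambda>j. \<beta> $ j"]
        assms(3) by (simp add: inner_vec_def)
  qed
  then show ?thesis by (simp add: emp_mean_sum_cmult)
qed

lemma emp_mean_weighted_inner:
  fixes \<phi> :: "'z \<Rightarrow> real ^ 'd"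
  shows "emp_mean n xs (\<lambda>x. h x * (\<beta> \<bullet> \<phi> (Z x))) =
    (\<Sum>j\<in>UNIV. \<beta> $ j * emp_mean n xs (\<lambda>x. h x * \<phi> (Z x) $ j))"
  by (simp add: emp_mean_sum_cmult[symmetric] inner_vec_def sum_distrib_left mult.left_commute)

text \<open>The deterministic core: an identity for a fixed sample, with the estimators treated as
  fixed vectors and functions.\<close>

lemma chi_hat_augmented:
  fixes \<phi> :: "'z \<Rightarrow> real ^ 'd"
  assumes "function_space A" and "function_space B"
    and m1: "\<And>i. i < n \<Longrightarrow> linear_functional_on A (m1 (xs i))"
    and m2: "\<And>i. i < n \<Longrightarrow> linear_functional_on B (m2 (xs i))"
    and \<phi>: "\<And>j. (\<lambda>z. \<phi> z $ j) \<in> A"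
    and score: "emp_mean n xs (\<lambda>x. sab x * b (Z x) * (\<phi> (Z x) \<bullet> \<beta>') + m2 x b) = 0"
    and nz: "\<And>j. emp_mean n xs (\<lambda>x. m1 x (\<lambda>z. \<phi> z $ j)) \<noteq> 0"
    and \<gamma>: "\<And>j. \<gamma> $ j = emp_mean n xs (\<lambda>x. - sab x * b (Z x) * \<phi> (Z x) $ j) /
                     emp_mean n xs (\<lambda>x. m1 x (\<lambda>z. \<phi> z $ j))"
    and aug: "\<And>j. \<beta>aug $ j = (1 - \<gamma> $ j) * \<beta> $ j + \<gamma> $ j * \<beta>' $ j"
  shows "chi_hat n xs Z sab m1 m2 (\<lambda>z. \<beta> \<bullet> \<phi> z) b =
    chi_hat n xs Z sab m1 m2 (\<lambda>z. \<beta>aug \<bullet> \<phi> z) (\<lambda>z. 0)"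
proof -
  define u where "u j = emp_mean n xs (\<lambda>x. m1 x (\<lambda>z. \<phi> z $ j))" for j
  define w where "w j = emp_mean n xs (\<lambda>x. sab x * b (Z x) * \<phi> (Z x) $ j)" for j
  \<comment> \<open>Stated for arbitrary coefficients, since it is applied both to \<beta> and to
    \<open>\<beta>'\<close>.\<close>
  have weighted: "emp_mean n xs (\<lambda>x. sab x * b (Z x) * (\<beta> \<bullet> \<phi> (Z x))) = (\<Sum>j\<in>UNIV. \<beta> $ j * w j)"
    for \<beta>
    unfolding w_def by (rule emp_mean_weighted_inner)
  have m1_inner: "emp_mean n xs (\<lambda>x. m1 x (\<lambda>z. \<beta> \<bullet> \<phi> z)) = (\<Sum>j\<in>UNIV. \<beta> $ j * u j)" for \<beta>
    unfolding u_def by (rule emp_mean_linear_functional[where A = A]) (use assms(1) m1 \<phi> in auto)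
  \<comment> \<open>The score equation splits by additivity and is solved for its \<open>m2\<close>
    part.\<close>
  have m2_b: "emp_mean n xs (\<lambda>x. m2 x b) = - (\<Sum>j\<in>UNIV. \<beta>' $ j * w j)"
    using score weighted[of \<beta>'] by (simp add: emp_mean_add inner_commute)
  have "emp_mean n xs (\<lambda>x. m2 x (\<lambda>z. 0)) = emp_mean n xs (\<lambda>x. 0)"
    by (rule emp_mean_cong) (use linear_functional_on_zero[OF assms(2) m2] in simp)
  then have m2_0: "emp_mean n xs (\<lambda>x. m2 x (\<lambda>z. 0)) = 0"
    by (simp add: emp_mean_def)
  \<comment> \<open>The nonzero denominator cancels; the sign comes from \<open>- sab\<close> in the
    numerator.\<close>
  have \<gamma>u: "\<gamma> $ j * u j = - w j" for j
    using nz[of j] by (simp add: \<gamma> u_def w_def emp_mean_uminus)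
  have \<beta>aug_u: "\<beta>aug $ j * u j = \<beta> $ j * w j + \<beta> $ j * u j - \<beta>' $ j * w j" for j
  proof -
    have "\<beta>aug $ j * u j = \<beta> $ j * u j - \<beta> $ j * (\<gamma> $ j * u j) + \<beta>' $ j * (\<gamma> $ j * u j)"
      by (simp add: aug algebra_simps)
    then show ?thesis by (simp add: \<gamma>u)
  qed
  have "chi_hat n xs Z sab m1 m2 (\<lambda>z. \<beta> \<bullet> \<phi> z) b =
      (\<Sum>j\<in>UNIV. \<beta> $ j * w j) + (\<Sum>j\<in>UNIV. \<beta> $ j * u j) - (\<Sum>j\<in>UNIV. \<beta>' $ j * w j)"
    \<comment> \<open>\<open>chi_hat\<close> has the factor \<open>b\<close> last,
      \<open>weighted\<close> has it before the inner product; commuting it aligns the two.\<close>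
    using weighted[of \<beta>] by (simp add: chi_hat_def m1_inner m2_b mult.assoc mult.commute[of "b _"])
  also have "\<dots> = (\<Sum>j\<in>UNIV. \<beta>aug $ j * u j)"
    by (simp add: \<beta>aug_u sum.distrib sum_subtractf)
  also have "\<dots> = chi_hat n xs Z sab m1 m2 (\<lambda>z. \<beta>aug \<bullet> \<phi> z) (\<lambda>z. 0)"
    \<comment> \<open>The \<open>sab\<close> term has the factor 0, which leaves the empirical mean
      of the zero function for the second call.\<close>
    by (simp add: chi_hat_def m1_inner m2_0) (simp add: emp_mean_def)
  finally show ?thesis .
qed

theorem proposition1:
  fixes I J :: "'i set" and C :: "'i \<Rightarrow> 'c measure"
    and S SZ :: "('i \<Rightarrow> 'c) measure" and Z :: "('i \<Rightarrow> 'c) \<Rightarrow> ('i \<Rightarrow> 'c)"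
    and M :: "('i \<Rightarrow> 'c) measure set" and P0 :: "('i \<Rightarrow> 'c) measure"
    and chi :: "('i \<Rightarrow> 'c) measure \<Rightarrow> real"
    and chi1 :: "('i \<Rightarrow> 'c) measure \<Rightarrow> ('i \<Rightarrow> 'c) \<Rightarrow> real"
    and sab :: "('i \<Rightarrow> 'c) \<Rightarrow> real"
    and a b :: "('i \<Rightarrow> 'c) measure \<Rightarrow> ('i \<Rightarrow> 'c) \<Rightarrow> real"
    and A B :: "(('i \<Rightarrow> 'c) \<Rightarrow> real) set"
    and m1 m2 :: "('i \<Rightarrow> 'c) \<Rightarrow> (('i \<Rightarrow> 'c) \<Rightarrow> real) \<Rightarrow> real"
    and N :: "'w measure" and n :: nat and X :: "nat \<Rightarrow> 'w \<Rightarrow> 'i \<Rightarrow> 'c" and \<omega> :: 'w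
    and xs :: "nat \<Rightarrow> 'i \<Rightarrow> 'c"
    and \<phi> :: "('i \<Rightarrow> 'c) \<Rightarrow> real ^ 'd"
    and beta_hat beta_tilde :: "'w \<Rightarrow> real ^ 'd"
    and b_hat :: "'w \<Rightarrow> ('i \<Rightarrow> 'c) \<Rightarrow> real"
    and \<gamma> beta_aug :: "real ^ 'd"
    and a_hat a_aug :: "('i \<Rightarrow> 'c) \<Rightarrow> real"
  \<comment> \<open>the observation O is a random vector with components indexed by I, and Z is its subvector
     of components in J\<close>
  assumes "finite I" and "J \<subseteq> I"
    and "S = PiM I C" and "SZ = PiM J C" and "Z = (\<lambda>x. restrict x J)"
    and "nonparametric_model S M"
    and "\<And>P. P \<in> M \<Longrightarrow> influence_function M chi P (chi1 P)"
    and "\<And>P \<psi>. P \<in> M \<Longrightarrow> influence_function M chi P \<psi> \<Longrightarrow> AE x in P. \<psi> x = chi1 P x"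
    and "mixed_bias_property S SZ Z M chi chi1 sab a b"
    and "function_space A" and "function_space B"
    and "\<And>x. x \<in> space S \<Longrightarrow> linear_functional_on A (m1 x)"
    and "\<And>x. x \<in> space S \<Longrightarrow> linear_functional_on B (m2 x)"
    and "\<And>P. P \<in> M \<Longrightarrow> a P \<in> A" and "\<And>P. P \<in> M \<Longrightarrow> b P \<in> B"
    and "\<And>P. P \<in> M \<Longrightarrow> AE x in P.
           chi1 P x = sab x * a P (Z x) * b P (Z x) + m1 x (a P) + m2 x (b P) - chi P"
    and "\<And>P. P \<in> M \<Longrightarrow> integrable P sab"
    and "\<And>P. P \<in> M \<Longrightarrow>
           AE x in P. real_cond_exp P (vimage_algebra (space P) Z SZ) sab x \<noteq> 0"
  \<comment> \<open>i.i.d. sample of size n from P0, realized at the outcome \<omega>\<close>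
    and "P0 \<in> M" and "1 \<le> n" and "prob_space N"
    and "prob_space.indep_vars N (\<lambda>_. S) X {..<n}"
    and "\<And>i. i < n \<Longrightarrow> distr N S (X i) = P0"
    and "\<omega> \<in> space N" and "xs = (\<lambda>i. X i \<omega>)"
    and "\<And>j. (\<lambda>z. \<phi> z $ j) \<in> A" and "b_hat \<omega> \<in> B"
    and "a_hat = (\<lambda>z. beta_hat \<omega> \<bullet> \<phi> z)"
    and "emp_mean n xs
           (\<lambda>x. sab x * b_hat \<omega> (Z x) * (\<phi> (Z x) \<bullet> beta_tilde \<omega>) + m2 x (b_hat \<omega>)) = 0"
    and "\<And>j. emp_mean n xs (\<lambda>x. m1 x (\<lambda>z. \<phi> z $ j)) \<noteq> 0"
    and "\<And>j. \<gamma> $ j = emp_mean n xs (\<lambda>x. - sab x * b_hat \<omega> (Z x) * \<phi> (Z x) $ j) /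
                     emp_mean n xs (\<lambda>x. m1 x (\<lambda>z. \<phi> z $ j))"
    and "\<And>j. beta_aug $ j = (1 - \<gamma> $ j) * beta_hat \<omega> $ j + \<gamma> $ j * beta_tilde \<omega> $ j"
    and "a_aug = (\<lambda>z. beta_aug \<bullet> \<phi> z)"
  shows "chi_hat n xs Z sab m1 m2 a_hat (b_hat \<omega>) = chi_hat n xs Z sab m1 m2 a_aug (\<lambda>z. 0)"
proof -
  \<comment> \<open>Linearity of \<open>m1\<close> and \<open>m2\<close> is given on
    \<open>space S\<close>, so the realized observations must lie there; independence of the
    \<open>X i\<close> includes their measurability.\<close>
  have "xs i \<in> space S" if "i < n" for i
  proof -
    have "X i \<in> measurable N S"
      using assms(21,22) that by (simp add: prob_space.indep_vars_def2)
    then show ?thesis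
      using assms(24,25) by (auto dest: measurable_space)
  qed
  then show ?thesis
    unfolding assms(28) assms(33)
    by (intro chi_hat_augmented[where A = A and B = B and \<gamma> = \<gamma> and \<beta>' = "beta_tilde \<omega>"])
      (use assms(10-13,26,29-32) in auto)
qed

end
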